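(* Let $L_2$ be the five-dimensional complex solvable Leibniz algebra with basis $\{e_1,e_2,e_3,x_1,x_2\}$ and products $$[e_1,e_1]=e_3,\ [e_1,x_1]=e_1,\ [x_1,e_1]=-e_1,\ [e_3,x_1]=2e_3,\ [e_2,x_2]=e_2,$$ with nilradical $N=\langle e_1,e_2,e_3\rangle$. Let $\widehat L_2=L_2(\omega,l,r)$ be an extension of $L_2$ by the abelian algebra $\mathfrak h=\langle e_4\rangle$ (with $N\subseteq\ker l\cap\ker r$). Then $\widehat L_2$ is isomorphic to one of the following non-isomorphic algebras (basis $\{e_1,e_2,e_3,e_4,x_1,x_2\}$, $\delta\in\mathbb C$ a parameter): $\widehat L_2^1$: the products of $L_2$ together with $[x_2,e_1]=e_4$, $[e_4,x_1]=e_4$. $\widehat L_2^2$: the products of $L_2$ together with $[e_3,e_1]=e_4$, $[e_4,x_1]=3e_4$. $\widehat L_2^3$: the products of $L_2$ together with $[e_2,x_1]=e_4$, $[e_4,x_2]=e_4$. $\widehat L_2^4(\delta)$: the products of $L_2$ with $[e_2,x_2]$ replaced by $[e_2,x_2]=e_2+e_4$, together with $[e_2,x_1]=\delta e_4$, $[e_4,x_2]=e_4$. $\widehat L_2^5$: the products of $L_2$ together with $[e_2,e_1]=e_4$, $[e_4,x_1]=e_4$, $[e_4,x_2]=e_4$. $\widehat L_2^6$: the products of $L_2$ with $[e_1,x_1]$ and $[x_1,e_1]$ replaced by $[e_1,x_1]=e_1+e_4$, $[x_1,e_1]=-e_1-e_4$, together with $[e_4,x_1]=e_4$, $[x_1,e_4]=-e_4$.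 $\widehat L_2^7(\delta)$: the products of $L_2$ with $[e_1,x_1]$ and $[x_1,e_1]$ replaced by $[e_1,x_1]=e_1+\delta e_4$, $[x_1,e_1]=-e_1-\delta e_4$, together with $[e_1,x_2]=e_4$, $[x_2,e_1]=-e_4$, $[e_4,x_1]=e_4$, $[x_1,e_4]=-e_4$.
   Context: All algebras are over $\mathbb C$; products of basis elements not listed are zero. A (right) Leibniz algebra is a vector space with a bilinear bracket satisfying $[[x,y],z]=[x,[y,z]]+[[x,z],y]$. The nilradical is the maximal nilpotent ideal. Abelian extension: let $\mathfrak g$ be a Leibniz algebra and $\mathfrak h$ a vector space regarded as an abelian algebra (zero bracket). A representation $(l,r)$ of $\mathfrak g$ on $\mathfrak h$ is a pair of linear maps $l,r:\mathfrak g\to\mathfrak{gl}(\mathfrak h)$ with $r_{[x,y]}=r_yr_x-r_xr_y$, $l_{[x,y]}=r_yl_x-l_xr_y$, $l_xl_y=-l_xr_y$ for all $x,y\in\mathfrak g$. A 2-cocycle with respect to $(l,r)$ is a bilinear map $\omega:\mathfrak g\times\mathfrak g\to\mathfrak h$ with $$\omega([x,y],z)-\omega(x,[y,z])-\omega([x,z],y)-l_x\omega(y,z)-r_y\omega(x,z)+r_z\omega(x,y)=0.$$ Then $\mathfrak g(\omega,l,r)$ denotes the Leibniz algebra $\mathfrak g\oplus\mathfrak h$ with bracket $[x+a,y+b]=[x,y]+\omega(x,y)+l_xb+r_ya$ ($x,y\in\mathfrak g$, $a,b\in\mathfrak h$). Here $\ker l=\{x\in\mathfrak g: l_x=0\}$,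 and similarly for $r$.
   Formalization: Two hypotheses are added: ω is not a coboundary (the extension is non-split) and (l,r) is not both zero (non-central). Without them the claim fails, e.g. ω=0, l=0, r_{x1}=7, r_{x2}=5; no excluded extension is isomorphic to a listed algebra. *)

theory Defs
  imports "HOL-Analysis.Analysis"
begin

section \<open>Right Leibniz algebras over the complex numbers\<close>

text \<open>There is no class of complex vector spaces in the libraries, so the scalar multiplication is an
  explicit parameter and linearity is \<^const>\<open>Vector_Spaces.linear\<close>. (The constant
  \<^const>\<open>Real_Vector_Spaces.linear\<close> would only mean real linearity.)\<close>

definition bilinear_wrt ::
  "(complex \<Rightarrow> 'a::ab_group_add \<Rightarrow> 'a) \<Rightarrow> (complex \<Rightarrow> 'b::ab_group_add \<Rightarrow> 'b) \<Rightarrow>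
   (complex \<Rightarrow> 'c::ab_group_add \<Rightarrow> 'c) \<Rightarrow> ('a \<Rightarrow> 'b \<Rightarrow> 'c) \<Rightarrow> bool" where
  "bilinear_wrt sa sb sc B \<longleftrightarrow>
     (\<forall>x. Vector_Spaces.linear sb sc (B x)) \<and> (\<forall>y. Vector_Spaces.linear sa sc (\<lambda>x. B x y))"

locale leibniz_algebra = vector_space scale
  for scale :: "complex \<Rightarrow> 'a::ab_group_add \<Rightarrow> 'a" +
  fixes br :: "'a \<Rightarrow> 'a \<Rightarrow> 'a"
  assumes bilinear_br: "bilinear_wrt scale scale scale br"
    and leibniz: "br (br x y) z = br x (br y z) + br (br x z) y"
begin

definition set_br :: "'a set \<Rightarrow> 'a set \<Rightarrow> 'a set" where
  "set_br A B = span {br a b | a b. a \<in> A \<and> b \<in> B}"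

definition is_ideal :: "'a set \<Rightarrow> bool" where
  "is_ideal I \<longleftrightarrow> subspace I \<and> (\<forall>x. \<forall>a\<in>I. br x a \<in> I \<and> br a x \<in> I)"

primrec lower_central :: "'a set \<Rightarrow> nat \<Rightarrow> 'a set" where
  "lower_central A 0 = A"
| "lower_central A (Suc k) = set_br (lower_central A k) A"

primrec derived_series :: "'a set \<Rightarrow> nat \<Rightarrow> 'a set" where
  "derived_series A 0 = A"
| "derived_series A (Suc k) = set_br (derived_series A k) (derived_series A k)"

definition nilpotent :: "'a set \<Rightarrow> bool" where
  "nilpotent A \<longleftrightarrow> (\<exists>k. lower_central A k = {0})"

definition solvable :: bool where
  "solvable \<longleftrightarrow> (\<exists>k. derived_series UNIV k = {0})"

definition is_nilradical :: "'a set \<Rightarrow> bool" where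
  "is_nilradical N \<longleftrightarrow> is_ideal N \<and> nilpotent N \<and> (\<forall>I. is_ideal I \<and> nilpotent I \<longrightarrow> I \<subseteq> N)"

end

definition isomorphic ::
  "(complex \<Rightarrow> 'a::ab_group_add \<Rightarrow> 'a) \<Rightarrow> ('a \<Rightarrow> 'a \<Rightarrow> 'a) \<Rightarrow>
   (complex \<Rightarrow> 'b::ab_group_add \<Rightarrow> 'b) \<Rightarrow> ('b \<Rightarrow> 'b \<Rightarrow> 'b) \<Rightarrow> bool" where
  "isomorphic sa bra sb brb \<longleftrightarrow>
     (\<exists>\<phi>. Vector_Spaces.linear sa sb \<phi> \<and> bij \<phi> \<and> (\<forall>x y. \<phi> (bra x y) = brb (\<phi> x) (\<phi> y)))"


section \<open>Abelian extensions\<close>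

locale leibniz_rep = leibniz_algebra sg br + h: vector_space sh
  for sg :: "complex \<Rightarrow> 'g::ab_group_add \<Rightarrow> 'g" and br
    and sh :: "complex \<Rightarrow> 'h::ab_group_add \<Rightarrow> 'h" +
  fixes l r :: "'g \<Rightarrow> 'h \<Rightarrow> 'h"
  assumes bilinear_l: "bilinear_wrt sg sh sh l"
    and bilinear_r: "bilinear_wrt sg sh sh r"
    and r_br: "r (br x y) a = r y (r x a) - r x (r y a)"
    and l_br: "l (br x y) a = r y (l x a) - l x (r y a)"
    and l_l: "l x (l y a) = - l x (r y a)"

locale leibniz_cocycle = leibniz_rep sg br sh l r
  for sg :: "complex \<Rightarrow> 'g::ab_group_add \<Rightarrow> 'g" and br
    and sh :: "complex \<Rightarrow> 'h::ab_group_add \<Rightarrow> 'h" and l r +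
  fixes \<omega> :: "'g \<Rightarrow> 'g \<Rightarrow> 'h"
  assumes bilinear_cocycle: "bilinear_wrt sg sg sh \<omega>"
    and cocycle: "\<omega> (br x y) z - \<omega> x (br y z) - \<omega> (br x z) y
                  - l x (\<omega> y z) - r y (\<omega> x z) + r z (\<omega> x y) = 0"

definition act_ker :: "('g \<Rightarrow> 'h \<Rightarrow> 'h::zero) \<Rightarrow> 'g set" where
  "act_ker l = {x. \<forall>a. l x a = 0}"

definition trivial_rep :: "('g \<Rightarrow> 'h \<Rightarrow> 'h::zero) \<Rightarrow> ('g \<Rightarrow> 'h \<Rightarrow> 'h) \<Rightarrow> bool" where
  "trivial_rep l r \<longleftrightarrow> act_ker l = UNIV \<and> act_ker r = UNIV"

text \<open>Replacing the section \<open>x \<mapsto> x\<close> of the extension by \<open>x \<mapsto> x + f x\<close> changes the cocycle by a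
  term of the following form (up to sign), so a cocycle is of this form exactly if the extension splits.
  A classification of proper extensions has to leave out these cocycles, and likewise the trivial
  representation, where the extension is central.\<close>

definition coboundary ::
  "(complex \<Rightarrow> 'g::ab_group_add \<Rightarrow> 'g) \<Rightarrow> ('g \<Rightarrow> 'g \<Rightarrow> 'g) \<Rightarrow> (complex \<Rightarrow> 'h::ab_group_add \<Rightarrow> 'h) \<Rightarrow>
   ('g \<Rightarrow> 'h \<Rightarrow> 'h) \<Rightarrow> ('g \<Rightarrow> 'h \<Rightarrow> 'h) \<Rightarrow> ('g \<Rightarrow> 'g \<Rightarrow> 'h) \<Rightarrow> bool" where
  "coboundary sg br sh l r \<omega> \<longleftrightarrow>
     (\<exists>f. Vector_Spaces.linear sg sh f \<and> (\<forall>x y. \<omega> x y = f (br x y) - l x (f y) - r y (f x)))"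

definition ext_scale ::
  "(complex \<Rightarrow> 'g \<Rightarrow> 'g) \<Rightarrow> (complex \<Rightarrow> 'h \<Rightarrow> 'h) \<Rightarrow> complex \<Rightarrow> 'g \<times> 'h \<Rightarrow> 'g \<times> 'h" where
  "ext_scale sg sh = (\<lambda>c (x, a). (sg c x, sh c a))"

definition ext_br ::
  "('g \<Rightarrow> 'g \<Rightarrow> 'g) \<Rightarrow> ('g \<Rightarrow> 'g \<Rightarrow> 'h::ab_group_add) \<Rightarrow> ('g \<Rightarrow> 'h \<Rightarrow> 'h) \<Rightarrow> ('g \<Rightarrow> 'h \<Rightarrow> 'h) \<Rightarrow>
   'g \<times> 'h \<Rightarrow> 'g \<times> 'h \<Rightarrow> 'g \<times> 'h" where
  "ext_br br \<omega> l r = (\<lambda>(x, a) (y, b). (br x y, \<omega> x y + l x b + r y a))"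

lemma bilinear_wrt_simps:
  assumes "bilinear_wrt sa sb sc B"
  shows "B (x + x') y = B x y + B x' y" "B x (y + y') = B x y + B x y'"
    "B (sa c x) y = sc c (B x y)" "B x (sb c y) = sc c (B x y)"
  using assms unfolding bilinear_wrt_def Vector_Spaces.linear_iff by blast+

lemma bilinear_wrtI:
  assumes "vector_space sa" "vector_space sb" "vector_space sc"
    and "\<And>x x' y. B (x + x') y = B x y + B x' y" "\<And>x y y'. B x (y + y') = B x y + B x y'"
    and "\<And>c x y. B (sa c x) y = sc c (B x y)" "\<And>c x y. B x (sb c y) = sc c (B x y)"
  shows "bilinear_wrt sa sb sc B"
  using assms unfolding bilinear_wrt_def Vector_Spaces.linear_iff by blast

lemma (in leibniz_cocycle) leibniz_algebra_ext:
  "leibniz_algebra (ext_scale sg sh) (ext_br br \<omega> l r)"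
proof -
  note bil = bilinear_wrt_simps[OF bilinear_br] bilinear_wrt_simps[OF bilinear_l]
    bilinear_wrt_simps[OF bilinear_r] bilinear_wrt_simps[OF bilinear_cocycle]
  have vs: "vector_space (ext_scale sg sh)"
    by unfold_locales
      (auto simp: ext_scale_def scale_right_distrib scale_left_distrib
        h.scale_right_distrib h.scale_left_distrib)
  have "bilinear_wrt (ext_scale sg sh) (ext_scale sg sh) (ext_scale sg sh) (ext_br br \<omega> l r)"
    by (rule bilinear_wrtI[OF vs vs vs])
      (auto simp: ext_br_def ext_scale_def bil h.scale_right_distrib)
  moreover have "ext_br br \<omega> l r (ext_br br \<omega> l r u v) w =
      ext_br br \<omega> l r u (ext_br br \<omega> l r v w) + ext_br br \<omega> l r (ext_br br \<omega> l r u w) v" for u v w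
  proof -
    obtain x a where "u = (x, a)"
      by (cases u)
    moreover obtain y b where "v = (y, b)"
      by (cases v)
    moreover obtain z c where "w = (z, c)"
      by (cases w)
    ultimately have uvw: "u = (x, a)" "v = (y, b)" "w = (z, c)" .
    have eq: "\<omega> (br x y) z = \<omega> x (br y z) + \<omega> (br x z) y + l x (\<omega> y z) + r y (\<omega> x z) - r z (\<omega> x y)"
      using cocycle[of x y z] by (simp add: algebra_simps)
    have "\<omega> (br x y) z + l (br x y) c + r z (\<omega> x y + l x b + r y a) =
        (\<omega> x (br y z) + l x (\<omega> y z + l y c + r z b) + r (br y z) a) +
        (\<omega> (br x z) y + l (br x z) b + r y (\<omega> x z + l x c + r z a))"
      unfolding bil eq l_br[of x y c] l_br[of x z b] r_br[of y z a] l_l[of x y c]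
      by (simp add: algebra_simps)
    then show ?thesis
      unfolding uvw ext_br_def by (simp add: leibniz[of x y z])
  qed
  ultimately show ?thesis
    by (intro leibniz_algebra.intro leibniz_algebra_axioms.intro vs)
qed


section \<open>Algebras given by multiplication tables\<close>

abbreviation bas :: "'n \<Rightarrow> complex^'n::finite" where
  "bas i \<equiv> axis i 1"

text \<open>A table lists products of basis vectors. The first entry for a pair counts, so a new entry put in front
  replaces an old one, and pairs without an entry have product zero.\<close>

type_synonym 'n table = "(('n \<times> 'n) \<times> (complex^'n)) list"

definition table_prod :: "'n::finite table \<Rightarrow> 'n \<Rightarrow> 'n \<Rightarrow> complex^'n" where
  "table_prod T i j = (case map_of T (i, j) of None \<Rightarrow> 0 | Some v \<Rightarrow> v)"

definition table_br :: "'n::finite table \<Rightarrow> complex^'n \<Rightarrow> complex^'n \<Rightarrow> complex^'n" where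
  "table_br T u v = (\<Sum>i\<in>UNIV. \<Sum>j\<in>UNIV. (u $ i * v $ j) *s table_prod T i j)"

datatype idx5 = E1 | E2 | E3 | X1 | X2

datatype idx6 = E1' | E2' | E3' | E4' | X1' | X2'

lemma UNIV_idx5: "(UNIV :: idx5 set) = {E1, E2, E3, X1, X2}"
  using idx5.exhaust by blast

lemma UNIV_idx6: "(UNIV :: idx6 set) = {E1', E2', E3', E4', X1', X2'}"
  using idx6.exhaust by blast

instance idx5 :: finite
  by standard (simp add: UNIV_idx5)

instance idx6 :: finite
  by standard (simp add: UNIV_idx6)

definition L2_table :: "'n \<Rightarrow> 'n \<Rightarrow> 'n \<Rightarrow> 'n \<Rightarrow> 'n \<Rightarrow> 'n::finite table" where
  "L2_table e1 e2 e3 x1 x2 =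
     [((e1, e1), bas e3), ((e1, x1), bas e1), ((x1, e1), - bas e1), ((e3, x1), 2 *s bas e3),
      ((e2, x2), bas e2)]"

definition L2 :: "complex^idx5 \<Rightarrow> complex^idx5 \<Rightarrow> complex^idx5" where
  "L2 = table_br (L2_table E1 E2 E3 X1 X2)"

definition L2_nil :: "(complex^idx5) set" where
  "L2_nil = vec.span {bas E1, bas E2, bas E3}"

datatype label = Ext1 | Ext2 | Ext3 | Ext4 complex | Ext5 | Ext6 | Ext7 complex

fun extra_table :: "label \<Rightarrow> idx6 table" where
  "extra_table Ext1 = [((X2', E1'), bas E4'), ((E4', X1'), bas E4')]"
| "extra_table Ext2 = [((E3', E1'), bas E4'), ((E4', X1'), 3 *s bas E4')]"
| "extra_table Ext3 = [((E2', X1'), bas E4'), ((E4', X2'), bas E4')]"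
| "extra_table (Ext4 \<delta>) =
     [((E2', X2'), bas E2' + bas E4'), ((E2', X1'), \<delta> *s bas E4'), ((E4', X2'), bas E4')]"
| "extra_table Ext5 =
     [((E2', E1'), bas E4'), ((E4', X1'), bas E4'), ((E4', X2'), bas E4')]"
| "extra_table Ext6 =
     [((E1', X1'), bas E1' + bas E4'), ((X1', E1'), - bas E1' - bas E4'),
      ((E4', X1'), bas E4'), ((X1', E4'), - bas E4')]"
| "extra_table (Ext7 \<delta>) =
     [((E1', X1'), bas E1' + \<delta> *s bas E4'), ((X1', E1'), - bas E1' - \<delta> *s bas E4'),
      ((E1', X2'), bas E4'), ((X2', E1'), - bas E4'),
      ((E4', X1'), bas E4'), ((X1', E4'), - bas E4')]"

definition hatL2 :: "label \<Rightarrow> complex^idx6 \<Rightarrow> complex^idx6 \<Rightarrow> complex^idx6" where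
  "hatL2 k = table_br (extra_table k @ L2_table E1' E2' E3' X1' X2')"


section \<open>The algebra \<open>L2\<close> is solvable with the stated nilradical\<close>

lemma vector_space_vec: "vector_space ((*s) :: complex \<Rightarrow> complex^'n \<Rightarrow> complex^'n)"
  by unfold_locales

lemma bilinear_table_br: "bilinear_wrt (*s) (*s) (*s) (table_br T)"
  by (rule bilinear_wrtI[OF vector_space_vec vector_space_vec vector_space_vec])
    (auto simp: table_br_def vec_eq_iff algebra_simps sum.distrib sum_distrib_left)

lemma sum_idx5: "(\<Sum>i\<in>UNIV. f i) = f E1 + f E2 + f E3 + f X1 + f X2" for f :: "idx5 \<Rightarrow> complex"
  by (simp add: UNIV_idx5)

lemma L2_nth:
  "L2 u v $ E1 = u $ E1 * v $ X1 - u $ X1 * v $ E1"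
  "L2 u v $ E2 = u $ E2 * v $ X2"
  "L2 u v $ E3 = u $ E1 * v $ E1 + 2 * u $ E3 * v $ X1"
  "L2 u v $ X1 = 0"
  "L2 u v $ X2 = 0"
  by (simp_all add: L2_def table_br_def sum_idx5 table_prod_def L2_table_def axis_def)

lemma vec5_eq_iff: "u = v \<longleftrightarrow> u $ E1 = v $ E1 \<and> u $ E2 = v $ E2 \<and> u $ E3 = v $ E3 \<and>
    u $ X1 = v $ X1 \<and> u $ X2 = v $ X2" for u v :: "complex^idx5"
  by (metis (full_types) idx5.exhaust vec_eq_iff)

interpretation L2: leibniz_algebra "(*s)" L2
proof
  show "bilinear_wrt (*s) (*s) (*s) L2"
    unfolding L2_def by (rule bilinear_table_br)
  show "L2 (L2 x y) z = L2 x (L2 y z) + L2 (L2 x z) y" for x y z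
    by (simp add: vec5_eq_iff L2_nth algebra_simps)
qed

lemma L2_nil_eq: "L2_nil = {u. u $ X1 = 0 \<and> u $ X2 = 0}"
proof
  have "vec.subspace {u :: complex^idx5. u $ X1 = 0 \<and> u $ X2 = 0}"
    by (auto simp: vec.subspace_def)
  then show "L2_nil \<subseteq> {u. u $ X1 = 0 \<and> u $ X2 = 0}"
    unfolding L2_nil_def by (intro vec.span_minimal) (auto simp: axis_def)
  show "{u. u $ X1 = 0 \<and> u $ X2 = 0} \<subseteq> L2_nil"
  proof
    fix u :: "complex^idx5"
    assume "u \<in> {u. u $ X1 = 0 \<and> u $ X2 = 0}"
    then have "u = u $ E1 *s bas E1 + u $ E2 *s bas E2 + u $ E3 *s bas E3"
      by (simp add: vec5_eq_iff axis_def)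
    also have "\<dots> \<in> L2_nil"
      unfolding L2_nil_def by (intro vec.span_add vec.span_scale vec.span_base) auto
    finally show "u \<in> L2_nil" .
  qed
qed

lemma L2_set_br_induct:
  assumes "vec.subspace {u. P u}" "\<And>a b. a \<in> A \<Longrightarrow> b \<in> B \<Longrightarrow> P (L2 a b)"
  shows "\<forall>u\<in>L2.set_br A B. P u"
proof -
  have "L2.set_br A B \<subseteq> {u. P u}"
    unfolding L2.set_br_def using assms by (intro vec.span_minimal) auto
  then show ?thesis
    by blast
qed

lemma L2_set_brI: "a \<in> A \<Longrightarrow> b \<in> B \<Longrightarrow> L2 a b \<in> L2.set_br A B"
  unfolding L2.set_br_def by (intro vec.span_base) auto

lemma L2_set_br_zero: "0 \<in> L2.set_br A B"
  unfolding L2.set_br_def by (rule vec.span_zero)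

lemma solvable_L2: "L2.solvable"
proof -
  define D where "D = L2.derived_series UNIV"
  have D: "D (Suc k) = L2.set_br (D k) (D k)" for k
    by (simp add: D_def)
  have 1: "\<forall>u\<in>D 1. u $ X1 = 0 \<and> u $ X2 = 0"
    unfolding One_nat_def D by (rule L2_set_br_induct) (simp_all add: vec.subspace_def L2_nth)
  have 2: "\<forall>u\<in>D 2. u $ E1 = 0 \<and> u $ E2 = 0 \<and> u $ X1 = 0 \<and> u $ X2 = 0"
    unfolding Suc_1[symmetric] D
    using 1 by (intro L2_set_br_induct) (simp_all add: vec.subspace_def L2_nth)
  have "\<forall>u\<in>D (Suc 2). u = 0"
    unfolding D using 2
    by (intro L2_set_br_induct) (simp_all add: vec.subspace_def vec5_eq_iff L2_nth)
  moreover have "0 \<in> D (Suc 2)"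
    unfolding D by (rule L2_set_br_zero)
  ultimately have "D (Suc 2) = {0}"
    by blast
  then show ?thesis
    unfolding L2.solvable_def D_def by blast
qed

lemma is_nilradical_L2_nil: "L2.is_nilradical L2_nil"
proof -
  have "L2.is_ideal L2_nil"
    by (auto simp: L2.is_ideal_def L2_nil_eq vec.subspace_def L2_nth)
  moreover have "L2.nilpotent L2_nil"
  proof -
    define C where "C = L2.lower_central L2_nil"
    have C: "C (Suc k) = L2.set_br (C k) L2_nil" for k
      by (simp add: C_def)
    have C0: "C 0 = L2_nil"
      by (simp add: C_def)
    have 1: "\<forall>u\<in>C 1. u $ E1 = 0 \<and> u $ E2 = 0 \<and> u $ X1 = 0 \<and> u $ X2 = 0"
      unfolding One_nat_def C C0
      by (intro L2_set_br_induct) (simp_all add: vec.subspace_def L2_nth L2_nil_eq)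
    have "\<forall>u\<in>C (Suc 1). u = 0"
      unfolding C[of 1] using 1
      by (intro L2_set_br_induct) (simp_all add: vec.subspace_def vec5_eq_iff L2_nth L2_nil_eq)
    moreover have "0 \<in> C (Suc 1)"
      unfolding C by (rule L2_set_br_zero)
    ultimately have "C (Suc 1) = {0}"
      by blast
    then show ?thesis
      unfolding L2.nilpotent_def C_def by blast
  qed
  moreover have "I \<subseteq> L2_nil" if I: "L2.is_ideal I" "L2.nilpotent I" for I
  proof (rule ccontr)
    assume "\<not> I \<subseteq> L2_nil"
    then obtain v where v: "v \<in> I" and nz: "v $ X1 \<noteq> 0 \<or> v $ X2 \<noteq> 0"
      by (auto simp: L2_nil_eq)
    obtain k where k: "L2.lower_central I k = {0}"
      using I(2) by (auto simp: L2.nilpotent_def)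
    have br_I: "L2 x v \<in> I" for x
      using I(1) v by (auto simp: L2.is_ideal_def)
    have "\<exists>u\<in>L2.lower_central I n. u $ X1 = 0 \<and> u \<noteq> 0 \<and>
        (v $ X1 \<noteq> 0 \<longrightarrow> u $ E1 \<noteq> 0) \<and> (v $ X1 = 0 \<longrightarrow> u $ E2 \<noteq> 0)" for n
    proof (induction n)
      case 0
      show ?case
      proof (cases "v $ X1 = 0")
        case True
        then show ?thesis
          using br_I[of "bas E2"] nz by (intro bexI[of _ "L2 (bas E2) v"])
            (auto simp: L2_nth vec5_eq_iff axis_def)
      next
        case False
        then show ?thesis
          using br_I[of "bas E1"] by (intro bexI[of _ "L2 (bas E1) v"])
            (auto simp: L2_nth vec5_eq_iff axis_def)
      qed
    next
      case (Suc n)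
      then obtain u where u: "u \<in> L2.lower_central I n" "u $ X1 = 0"
        "v $ X1 \<noteq> 0 \<longrightarrow> u $ E1 \<noteq> 0" "v $ X1 = 0 \<longrightarrow> u $ E2 \<noteq> 0"
        by blast
      have "L2 u v \<in> L2.lower_central I (Suc n)"
        using u(1) v by (auto intro: L2_set_brI)
      with u(2-) nz show ?case
        by (intro bexI[of _ "L2 u v"]) (auto simp: L2_nth vec5_eq_iff)
    qed
    from this[of k] k show False
      by auto
  qed
  ultimately show ?thesis
    unfolding L2.is_nilradical_def by blast
qed


section \<open>The listed algebras are Leibniz algebras\<close>

lemma sum_idx6: "(\<Sum>i\<in>UNIV. f i) = f E1' + f E2' + f E3' + f E4' + f X1' + f X2'"
  for f :: "idx6 \<Rightarrow> complex"
  by (simp add: UNIV_idx6)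

lemma vec6_eq_iff: "u = v \<longleftrightarrow> u $ E1' = v $ E1' \<and> u $ E2' = v $ E2' \<and> u $ E3' = v $ E3' \<and>
    u $ E4' = v $ E4' \<and> u $ X1' = v $ X1' \<and> u $ X2' = v $ X2'" for u v :: "complex^idx6"
  by (metis (full_types) idx6.exhaust vec_eq_iff)

lemma hatL2_nths:
  "hatL2 k u v $ E1' = u $ E1' * v $ X1' - u $ X1' * v $ E1'"
  "hatL2 k u v $ E2' = u $ E2' * v $ X2'"
  "hatL2 k u v $ E3' = u $ E1' * v $ E1' + 2 * u $ E3' * v $ X1'"
  "hatL2 k u v $ X1' = 0"
  "hatL2 k u v $ X2' = 0"
  "hatL2 Ext1 u v $ E4' = u $ X2' * v $ E1' + u $ E4' * v $ X1'"
  "hatL2 Ext2 u v $ E4' = u $ E3' * v $ E1' + 3 * u $ E4' * v $ X1'"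
  "hatL2 Ext3 u v $ E4' = u $ E2' * v $ X1' + u $ E4' * v $ X2'"
  "hatL2 (Ext4 \<delta>) u v $ E4' = u $ E2' * v $ X2' + \<delta> * u $ E2' * v $ X1' + u $ E4' * v $ X2'"
  "hatL2 Ext5 u v $ E4' = u $ E2' * v $ E1' + u $ E4' * v $ X1' + u $ E4' * v $ X2'"
  "hatL2 Ext6 u v $ E4' = u $ E1' * v $ X1' - u $ X1' * v $ E1' + u $ E4' * v $ X1' - u $ X1' * v $ E4'"
  "hatL2 (Ext7 \<delta>) u v $ E4' = \<delta> * (u $ E1' * v $ X1' - u $ X1' * v $ E1') + u $ E1' * v $ X2'
     - u $ X2' * v $ E1' + u $ E4' * v $ X1' - u $ X1' * v $ E4'"
  by (cases k; simp add: hatL2_def table_br_def sum_idx6 table_prod_def L2_table_def axis_def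
      algebra_simps)+

lemma leibniz_algebra_hatL2: "leibniz_algebra (*s) (hatL2 k)"
proof -
  have "hatL2 k (hatL2 k x y) z = hatL2 k x (hatL2 k y z) + hatL2 k (hatL2 k x z) y" for x y z
  proof (cases k)
    case Ext1
    show ?thesis
      unfolding Ext1 by (simp add: vec6_eq_iff hatL2_nths algebra_simps)
  next
    case Ext2
    show ?thesis
      unfolding Ext2 by (simp add: vec6_eq_iff hatL2_nths algebra_simps)
  next
    case Ext3
    show ?thesis
      unfolding Ext3 by (simp add: vec6_eq_iff hatL2_nths algebra_simps)
  next
    case (Ext4 \<delta>)
    show ?thesis
      unfolding Ext4 by (simp add: vec6_eq_iff hatL2_nths algebra_simps)
  next
    case Ext5
    show ?thesis
      unfolding Ext5 by (simp add: vec6_eq_iff hatL2_nths algebra_simps)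
  next
    case Ext6
    show ?thesis
      unfolding Ext6 by (simp add: vec6_eq_iff hatL2_nths algebra_simps)
  next
    case (Ext7 \<delta>)
    show ?thesis
      unfolding Ext7 by (simp add: vec6_eq_iff hatL2_nths algebra_simps)
  qed
  moreover have "bilinear_wrt (*s) (*s) (*s) (hatL2 k)"
    unfolding hatL2_def by (rule bilinear_table_br)
  ultimately show ?thesis
    by (intro leibniz_algebra.intro leibniz_algebra_axioms.intro vector_space_vec)
qed

end

theory Submission
  imports Defs
begin

text \<open>On a line \<open>\<langle>e4\<rangle>\<close> the two actions are linear functionals \<open>lam\<close> and \<open>rho\<close> vanishing on the nilradical, and
  \<open>l x (l y a) = - l x (r y a)\<close> forces \<open>lam = 0\<close> or \<open>lam = - rho\<close>. Evaluating the cocycle identity on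
  basis vectors shows that modulo coboundaries a cocycle vanishes unless the weight
  \<open>(rho x1, rho x2)\<close> of \<open>e4\<close> is one of \<open>(1,0)\<close>, \<open>(3,0)\<close>, \<open>(0,1)\<close>, \<open>(1,1)\<close> if \<open>lam = 0\<close>, or is \<open>(1,0)\<close> if
  \<open>lam = - rho\<close>. The remaining classes form a space of dimension one or two, and rescaling \<open>e4\<close> makes it a
  point or a projective line; the latter gives the parameter families \<open>Ext4\<close> and \<open>Ext7\<close> and their points
  at infinity \<open>Ext3\<close> and \<open>Ext6\<close>.

  The restriction of the bracket to the derived algebra, which is the nilradical, separates \<open>Ext2\<close> and \<open>Ext5\<close> from
  each other and from the rest. In the other algebras it is \<open>u1 v1 e3\<close>, so an isomorphism maps \<open>e3\<close> to a
  multiple of itself and must match the weights of \<open>x1\<close> and \<open>x2\<close>; comparing coefficients at \<open>e2\<close> and \<open>e4\<close> does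
  the rest.\<close>

section \<open>One-dimensional extensions of \<open>L2\<close>\<close>

text \<open>Cocycle relations of the shape a * d = b * c say that (c, d) is parallel to (a, b). The
  factor \<open>g\<close> becomes, up to sign, the value of a cochain that removes both
  coefficients.\<close>

lemma ratio_exists:
  fixes a b c d :: "'a::field"
  assumes "a * d = b * c" "a \<noteq> 0 \<or> b \<noteq> 0"
  shows "\<exists>g. c = a * g \<and> d = b * g"
proof (cases "a = 0")
  case True
  with assms show ?thesis
    by (intro exI[of _ "d / b"]) auto
next
  case False
  with assms show ?thesis
    by (intro exI[of _ "c / a"]) (auto simp: field_simps)
qed

lemma vec5_expand: "u = u $ E1 *s bas E1 + u $ E2 *s bas E2 + u $ E3 *s bas E3
    + u $ X1 *s bas X1 + u $ X2 *s bas X2"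
  by (simp add: vec5_eq_iff axis_def)

lemma linear5_expand:
  assumes "Vector_Spaces.linear (*s) (*) F"
  shows "F u = u $ E1 * F (bas E1) + u $ E2 * F (bas E2) + u $ E3 * F (bas E3)
    + u $ X1 * F (bas X1) + u $ X2 * F (bas X2)"
proof -
  have "F (v + v') = F v + F v'" "F (t *s v) = t * F v" for v v' t
    using assms by (simp_all add: Vector_Spaces.linear_iff)
  then show ?thesis
    by (subst vec5_expand[of u]) (simp only:)
qed

text \<open>Functionals on \<open>L2\<close> are coded by their values on the basis, so that a
  cochain can be defined by cases on the index.\<close>

definition lin5 :: "(idx5 \<Rightarrow> complex) \<Rightarrow> complex^idx5 \<Rightarrow> complex" where
  "lin5 f u = f E1 * u $ E1 + f E2 * u $ E2 + f E3 * u $ E3 + f X1 * u $ X1 + f X2 * u $ X2"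

lemma lin5_simps [simp]:
  "lin5 f (u + v) = lin5 f u + lin5 f v" "lin5 f (c *s u) = c * lin5 f u"
  by (simp_all add: lin5_def algebra_simps)

definition emb6 :: "complex^idx5 \<Rightarrow> complex \<Rightarrow> complex^idx6" where
  "emb6 u s = (\<chi> i. case i of E1' \<Rightarrow> u $ E1 | E2' \<Rightarrow> u $ E2 | E3' \<Rightarrow> u $ E3 | E4' \<Rightarrow> s
     | X1' \<Rightarrow> u $ X1 | X2' \<Rightarrow> u $ X2)"

lemma emb6_nth [simp]:
  "emb6 u s $ E1' = u $ E1" "emb6 u s $ E2' = u $ E2" "emb6 u s $ E3' = u $ E3"
  "emb6 u s $ E4' = s" "emb6 u s $ X1' = u $ X1" "emb6 u s $ X2' = u $ X2"
  by (simp_all add: emb6_def)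

section \<open>Coordinates on the line and weights of the action\<close>

locale L2_line_extension = leibniz_cocycle "(*s)" L2 sh l r \<omega>
  for sh :: "complex \<Rightarrow> 'h::ab_group_add \<Rightarrow> 'h" and l r \<omega> +
  fixes e4 :: 'h
  assumes e4_nonzero: "e4 \<noteq> 0"
    and span_e4: "module.span sh {e4} = UNIV"
    and nil_act_ker: "L2_nil \<subseteq> act_ker l \<inter> act_ker r"
    and nontrivial: "\<not> trivial_rep l r"
    and not_coboundary: "\<not> coboundary (*s) L2 sh l r \<omega>"
begin

definition coord :: "'h \<Rightarrow> complex" where
  "coord a = (THE c. sh c e4 = a)"

lemma sh_coord [simp]: "sh (coord a) e4 = a"
  and coord_sh: "coord (sh c e4) = c"
proof -
  have inj: "c = d" if "sh c e4 = sh d e4" for c d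
    using h.scale_right_imp_eq[OF e4_nonzero that] .
  have "a \<in> range (\<lambda>c. sh c e4)"
    using span_e4 h.span_singleton[of e4] by simp
  then have "\<exists>!c. sh c e4 = a"
    using inj by blast
  then show "sh (coord a) e4 = a"
    unfolding coord_def by (rule theI')
  show "coord (sh c e4) = c"
    unfolding coord_def using inj by (intro the_equality) auto
qed

lemma coord_e4 [simp]: "coord e4 = 1"
  using coord_sh[of 1] by simp

lemma coord_eqI: "a = sh c e4 \<Longrightarrow> coord a = c"
  by (simp add: coord_sh)

lemma coord_eq_iff: "a = b \<longleftrightarrow> coord a = coord b"
  by (metis sh_coord)

lemma coord_simps [simp]:
  "coord 0 = 0"
  "coord (a + b) = coord a + coord b"
  "coord (a - b) = coord a - coord b"
  "coord (- a) = - coord a"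
  "coord (sh c a) = c * coord a"
proof -
  show "coord 0 = 0"
    by (rule coord_eqI) simp
  show "coord (a + b) = coord a + coord b"
    by (rule coord_eqI) (simp add: h.scale_left_distrib)
  show "coord (a - b) = coord a - coord b"
    by (rule coord_eqI) (simp add: h.scale_left_diff_distrib)
  show "coord (- a) = - coord a"
    by (rule coord_eqI) simp
  show "coord (sh c a) = c * coord a"
    by (rule coord_eqI) (simp flip: h.scale_scale)
qed

definition lam :: "complex^idx5 \<Rightarrow> complex" where
  "lam u = coord (l u e4)"

definition rho :: "complex^idx5 \<Rightarrow> complex" where
  "rho u = coord (r u e4)"

definition W :: "complex^idx5 \<Rightarrow> complex^idx5 \<Rightarrow> complex" where
  "W u v = coord (\<omega> u v)"

lemma coord_l [simp]: "coord (l u a) = lam u * coord a"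
  using bilinear_wrt_simps(4)[OF bilinear_l, of u "coord a" e4] by (simp add: lam_def)

lemma coord_r [simp]: "coord (r u a) = rho u * coord a"
  using bilinear_wrt_simps(4)[OF bilinear_r, of u "coord a" e4] by (simp add: rho_def)

lemma linear_rho: "Vector_Spaces.linear (*s) (*) rho"
  by (simp add: Vector_Spaces.linear_iff rho_def vector_space_vec vector_space_over_itself.vector_space_axioms
    bilinear_wrt_simps[OF bilinear_r] del: coord_r)

lemma linear_W: "Vector_Spaces.linear (*s) (*) (W u)" "Vector_Spaces.linear (*s) (*) (\<lambda>u. W u v)"
  by (simp_all add: Vector_Spaces.linear_iff W_def vector_space_vec vector_space_over_itself.vector_space_axioms
    bilinear_wrt_simps[OF bilinear_cocycle])

definition w :: "idx5 \<Rightarrow> idx5 \<Rightarrow> complex" where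
  "w i j = W (bas i) (bas j)"

lemma W_expand: "W u v =
    u $ E1 * lin5 (w E1) v + u $ E2 * lin5 (w E2) v + u $ E3 * lin5 (w E3) v
    + u $ X1 * lin5 (w X1) v + u $ X2 * lin5 (w X2) v"
proof -
  have "W (bas i) v = lin5 (w i) v" for i
    using linear5_expand[OF linear_W(1)[of "bas i"], of v] by (simp add: w_def lin5_def mult.commute)
  then show ?thesis
    using linear5_expand[OF linear_W(2)[of v], of u] by simp
qed

definition p :: complex where "p = rho (bas X1)"
definition q :: complex where "q = rho (bas X2)"

lemma act_bas_nil:
  "lam (bas E1) = 0" "lam (bas E2) = 0" "lam (bas E3) = 0"
  "rho (bas E1) = 0" "rho (bas E2) = 0" "rho (bas E3) = 0"
proof -
  have "bas i \<in> L2_nil" if "i \<in> {E1, E2, E3}" for i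
    using that by (auto simp: L2_nil_eq axis_def)
  then have "l (bas i) e4 = 0 \<and> r (bas i) e4 = 0" if "i \<in> {E1, E2, E3}" for i
    using nil_act_ker that unfolding act_ker_def by blast
  then show "lam (bas E1) = 0" "lam (bas E2) = 0" "lam (bas E3) = 0"
    "rho (bas E1) = 0" "rho (bas E2) = 0" "rho (bas E3) = 0"
    by (simp_all add: lam_def rho_def)
qed

lemma rho_eq: "rho u = p * u $ X1 + q * u $ X2"
  using linear5_expand[OF linear_rho, of u] by (simp add: act_bas_nil p_def q_def)

lemma lam_mult: "lam u * (lam v + rho v) = 0"
  using arg_cong[OF l_l[of u v e4], of coord]
  by (simp add: distrib_left)

text \<open>A single \<open>v\<close> with lam v + rho v nonzero can be cancelled in
  \<open>lam_mult\<close>, which makes every \<open>lam u\<close> vanish.\<close>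

lemma lam_cases: "(\<forall>u. lam u = 0) \<or> (\<forall>u. lam u = - rho u)"
proof (rule disjCI)
  assume "\<not> (\<forall>u. lam u = - rho u)"
  then obtain v where "lam v + rho v \<noteq> 0"
    by (auto simp: eq_neg_iff_add_eq_0)
  then show "\<forall>u. lam u = 0"
    using lam_mult[of _ v] by auto
qed

text \<open>If p = q = 0 then rho = 0, and either alternative of \<open>lam_cases\<close> gives lam
  = 0, so the representation would be trivial.\<close>

lemma pq_nonzero: "p \<noteq> 0 \<or> q \<noteq> 0"
proof (rule ccontr)
  assume "\<not> (p \<noteq> 0 \<or> q \<noteq> 0)"
  then have "rho u = 0" "lam u = 0" for u
    using lam_cases by (auto simp: rho_eq)
  then have "l u a = 0" "r u a = 0" for u a
    by (simp_all add: coord_eq_iff)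
  with nontrivial show False
    by (simp add: trivial_rep_def act_ker_def)
qed

section \<open>Cocycles modulo coboundaries\<close>

lemma W_cocycle: "W (L2 x y) z - W x (L2 y z) - W (L2 x z) y
    - lam x * W y z - rho y * W x z + rho z * W x y = 0"
  using arg_cong[OF cocycle[of x y z], of coord] by (simp add: W_def)

text \<open>In the sum of the cocycle identities for (x, y, z) and (x, z, y) the terms with [x, y],
  with [x, z] and with the right action cancel.\<close>

lemma W_cocycle_symmetrized: "W x (L2 y z + L2 z y) = - lam x * (W y z + W z y)"
proof -
  have "W x (L2 y z + L2 z y) = W x (L2 y z) + W x (L2 z y)"
    using linear_W(1)[of x] by (simp add: Vector_Spaces.linear_iff)
  then show ?thesis
    using W_cocycle[of x y z] W_cocycle[of x z y] by algebra
qed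

lemma W_not_coboundary: "\<exists>u v. W u v \<noteq> lin5 f (L2 u v) - lam u * lin5 f v - rho v * lin5 f u"
proof (rule ccontr)
  assume "\<not> ?thesis"
  then have "coord (\<omega> u v) = lin5 f (L2 u v) - lam u * lin5 f v - rho v * lin5 f u" for u v
    by (auto simp: W_def)
  then have "\<omega> u v = sh (lin5 f (L2 u v)) e4 - l u (sh (lin5 f v) e4) - r v (sh (lin5 f u) e4)" for u v
    by (simp add: coord_eq_iff)
  moreover have "Vector_Spaces.linear (*s) sh (\<lambda>u. sh (lin5 f u) e4)"
    by (simp add: Vector_Spaces.linear_iff vector_space_vec h.vector_space_axioms h.scale_left_distrib)
  ultimately show False
    using not_coboundary unfolding coboundary_def by blast
qed

text \<open>The map (u, a) -> emb6 u (c a + f u) rescales \<open>e4\<close> by \<open>c\<close> and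
  changes the section by \<open>f\<close>. Coordinates other than \<open>E4'\<close> follow the
  table of \<open>L2\<close> for every \<open>k\<close>, so one equation remains: the homomorphism
  condition, with \<open>s\<close> and \<open>t\<close> the last coordinates of the two
  images.\<close>

lemma isomorphicI:
  assumes "c \<noteq> 0"
    and "\<And>u v s t. hatL2 k (emb6 u s) (emb6 v t) $ E4' =
      c * W u v + lin5 f (L2 u v) + lam u * (t - lin5 f v) + rho v * (s - lin5 f u)"
  shows "isomorphic (ext_scale (*s) sh) (ext_br L2 \<omega> l r) (*s) (hatL2 k)"
proof -
  define \<phi> where "\<phi> = (\<lambda>(u, a). emb6 u (c * coord a + lin5 f u))"
  define \<psi> where "\<psi> = (\<lambda>v. let u = (\<chi> i. case i of E1 \<Rightarrow> v $ E1' | E2 \<Rightarrow> v $ E2' | E3 \<Rightarrow> v $ E3'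
     | X1 \<Rightarrow> v $ X1' | X2 \<Rightarrow> v $ X2') in (u, sh ((v $ E4' - lin5 f u) / c) e4))"
  have "vector_space (ext_scale (*s) sh)"
    by unfold_locales
      (auto simp: ext_scale_def vec.scale_right_distrib vec.scale_left_distrib
        h.scale_right_distrib h.scale_left_distrib)
  then have "Vector_Spaces.linear (ext_scale (*s) sh) (*s) \<phi>"
    unfolding Vector_Spaces.linear_iff
    by (auto simp: vector_space_vec \<phi>_def ext_scale_def vec6_eq_iff algebra_simps)
  moreover have "bij \<phi>"
  proof (rule o_bij)
    show "\<psi> \<circ> \<phi> = id"
      using assms(1) by (auto simp: fun_eq_iff \<phi>_def \<psi>_def Let_def vec5_eq_iff lin5_def coord_eq_iff)
    show "\<phi> \<circ> \<psi> = id"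
      using assms(1) by (auto simp: fun_eq_iff \<phi>_def \<psi>_def Let_def vec6_eq_iff)
  qed
  moreover have "\<phi> (ext_br L2 \<omega> l r x y) = hatL2 k (\<phi> x) (\<phi> y)" for x y
    by (cases x; cases y)
      (auto simp: \<phi>_def ext_br_def vec6_eq_iff assms(2) hatL2_nths L2_nth algebra_simps simp flip: W_def)
  ultimately show ?thesis
    unfolding isomorphic_def by blast
qed

lemmas basis_simps = W_expand L2_nth lin5_def rho_eq axis_def

text \<open>The values of \<open>f\<close> on \<open>e1\<close> and \<open>e3\<close> are forced by \<open>[x1, e1] = - e1\<close> and \<open>[e1, e1] = e3\<close>; on the other
  basis vectors \<open>f\<close> is read off from the right action of \<open>x1\<close> and \<open>x2\<close>.\<close>

lemma right_extension_cocycle: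
  assumes "\<forall>u. lam u = 0"
  obtains f where
    "\<And>u v. W u v = lin5 f (L2 u v) - rho v * lin5 f u + w E2 E1 * u $ E2 * v $ E1
      + w E3 E1 * u $ E3 * v $ E1 + w X2 E1 * u $ X2 * v $ E1
      + (if p = 0 \<and> q = 1 then w E2 X1 * u $ E2 * v $ X1 + w E2 X2 * u $ E2 * v $ X2 else 0)"
    "w E2 E1 \<noteq> 0 \<Longrightarrow> p = 1 \<and> q = 1"
    "w E3 E1 \<noteq> 0 \<Longrightarrow> p = 3 \<and> q = 0"
    "w X2 E1 \<noteq> 0 \<Longrightarrow> p = 1 \<and> q = 0"
proof -
  have coc: "W (L2 x y) z - W x (L2 y z) - W (L2 x z) y - rho y * W x z + rho z * W x y = 0" for x y z
    using W_cocycle[of x y z] assms by simp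
  have sym: "W x (L2 y z + L2 z y) = 0" for x y z
    using W_cocycle_symmetrized[of x y z] assms by simp
  \<comment> \<open>Since 2 e3 = [e1, e1] + [e1, e1] and e2 = [e2, x2] + [x2, e2] are symmetrized
    brackets, \<open>sym\<close> kills the columns of e3 and e2.\<close>
  have zero3: "w i E3 = 0" for i
    using sym[of "bas i" "bas E1" "bas E1"] by (cases i) (simp_all add: basis_simps)
  have zero2: "w i E2 = 0" for i
    using sym[of "bas i" "bas E2" "bas X2"] by (cases i) (simp_all add: basis_simps)
  have e1: "w E3 X1 = (2 - p) * w E1 E1" "w E3 X2 = - q * w E1 E1"
    using coc[of "bas E1" "bas E1" "bas X1"] coc[of "bas E1" "bas E1" "bas X2"]
    by (simp_all add: basis_simps algebra_simps eq_neg_iff_add_eq_0)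
  have x1: "w E1 X1 = (p - 1) * w X1 E1" "w E1 X2 = q * w X1 E1"
    using coc[of "bas X1" "bas E1" "bas X1"] coc[of "bas X1" "bas E1" "bas X2"]
    by (simp_all add: basis_simps algebra_simps)
  \<comment> \<open>Under right multiplication by x1 and x2 the vectors e1, e2, e3, x2 have weights
    (1,0), (0,1), (2,0), (0,0). A coefficient at a pair can be nonzero only if the weights of the
    pair add up to the weight (p, q) of \<open>e4\<close>.\<close>
  have 21: "(p - 1) * w E2 E1 = 0" "(q - 1) * w E2 E1 = 0"
    using coc[of "bas E2" "bas E1" "bas X1"] coc[of "bas E2" "bas E1" "bas X2"]
    by (simp_all add: basis_simps algebra_simps)
  have 31: "(p - 3) * w E3 E1 = 0" "q * w E3 E1 = 0"
    using coc[of "bas E3" "bas E1" "bas X1"] coc[of "bas E3" "bas E1" "bas X2"]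
    by (simp_all add: basis_simps algebra_simps)
  have x21: "(p - 1) * w X2 E1 = 0" "q * w X2 E1 = 0"
    using coc[of "bas X2" "bas E1" "bas X1"] coc[of "bas X2" "bas E1" "bas X2"]
    by (simp_all add: basis_simps algebra_simps)
  have xx: "p * w X1 X2 = q * w X1 X1" "p * w X2 X2 = q * w X2 X1"
    using coc[of "bas X1" "bas X1" "bas X2"] coc[of "bas X2" "bas X1" "bas X2"]
    by (simp_all add: basis_simps algebra_simps)
  have 2: "p * w E2 X2 = (q - 1) * w E2 X1"
    using coc[of "bas E2" "bas X1" "bas X2"] by (simp add: basis_simps algebra_simps)
  obtain g1 where g1: "w X1 X1 = p * g1" "w X1 X2 = q * g1"
    using ratio_exists[OF xx(1) pq_nonzero] by blast
  obtain g2 where g2: "w X2 X1 = p * g2" "w X2 X2 = q * g2"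
    using ratio_exists[OF xx(2) pq_nonzero] by blast
  \<comment> \<open>A coboundary has coefficients - p f(e2) and (1 - q) f(e2) at (e2, x1) and (e2,
    x2). Both vanish for p = 0 and q = 1, where these entries of the cocycle therefore
    survive.\<close>
  obtain f2 where f2: "\<not> (p = 0 \<and> q = 1) \<Longrightarrow> w E2 X1 = p * f2 \<and> w E2 X2 = (q - 1) * f2"
    using ratio_exists[OF 2] by auto
  define f where "f = (\<lambda>i. case i of E1 \<Rightarrow> - w X1 E1 | E2 \<Rightarrow> if p = 0 \<and> q = 1 then 0 else - f2
    | E3 \<Rightarrow> w E1 E1 | X1 \<Rightarrow> - g1 | X2 \<Rightarrow> - g2)"
  show thesis
  proof (rule that)
    show "W u v = lin5 f (L2 u v) - rho v * lin5 f u + w E2 E1 * u $ E2 * v $ E1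
      + w E3 E1 * u $ E3 * v $ E1 + w X2 E1 * u $ X2 * v $ E1
      + (if p = 0 \<and> q = 1 then w E2 X1 * u $ E2 * v $ X1 + w E2 X2 * u $ E2 * v $ X2 else 0)" for u v
    proof (cases "p = 0 \<and> q = 1")
      case True
      then show ?thesis
        by (simp add: W_expand lin5_def L2_nth rho_eq f_def zero2 zero3 e1 x1 g1 g2 algebra_simps)
    next
      case False
      then show ?thesis
        by (simp add: W_expand lin5_def L2_nth rho_eq f_def zero2 zero3 e1 x1 g1 g2 f2[OF False] algebra_simps)
    qed
  qed (use 21 31 x21 in auto)
qed

text \<open>The symmetrized identity fixes the columns of e2 and e3 as multiples of
  \<open>rho\<close> and makes W skew on pairs with skew bracket. A coboundary changes the remaining
  entries at (e1, x1) and (e1, x2) by (1 - p) f(e1) and - q f(e1), so they can be removed unless p =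
  1 and q = 0.\<close>

lemma symmetric_extension_cocycle:
  assumes "\<forall>u. lam u = - rho u"
  obtains f where
    "\<And>u v. W u v = lin5 f (L2 u v) - lam u * lin5 f v - rho v * lin5 f u
      + (if p = 1 \<and> q = 0 then w E1 X1 * (u $ E1 * v $ X1 - u $ X1 * v $ E1)
          + w E1 X2 * (u $ E1 * v $ X2 - u $ X2 * v $ E1) else 0)"
proof -
  have coc: "W (L2 x y) z - W x (L2 y z) - W (L2 x z) y + rho x * W y z - rho y * W x z + rho z * W x y = 0"
    for x y z
    using W_cocycle[of x y z] assms by simp
  have sym: "W x (L2 y z + L2 z y) = rho x * (W y z + W z y)" for x y z
    using W_cocycle_symmetrized[of x y z] assms by simp
  \<comment> \<open>The symmetrized identity carries a factor \<open>rho x\<close>; this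
    \<open>x\<close> allows dividing by it.\<close>
  obtain x where x: "rho x \<noteq> 0"
    using pq_nonzero by (auto simp: p_def q_def)
  define f2 where "f2 = w E2 X2 + w X2 E2"
  have We3: "W y (bas E3) = rho y * w E1 E1" for y
  proof -
    have "L2 (bas E1) (bas E1) + L2 (bas E1) (bas E1) = 2 *s bas E3"
      by (simp add: vec5_eq_iff L2_nth axis_def)
    then show ?thesis
      using sym[of y "bas E1" "bas E1"] linear_W(1)[of y]
      by (simp add: Vector_Spaces.linear_iff w_def)
  qed
  have We2: "W y (bas E2) = rho y * f2" for y
  proof -
    have "L2 (bas E2) (bas X2) + L2 (bas X2) (bas E2) = bas E2"
      by (simp add: vec5_eq_iff L2_nth axis_def)
    then show ?thesis
      using sym[of y "bas E2" "bas X2"] by (simp add: w_def f2_def)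
  qed
  have zero: "w E1 E2 = 0" "w E1 E3 = 0" "w E2 E2 = 0" "w E2 E3 = 0" "w E3 E2 = 0" "w E3 E3 = 0"
    "w X1 E2 = p * f2" "w X2 E2 = q * f2" "w X1 E3 = p * w E1 E1" "w X2 E3 = q * w E1 E1"
    by (simp_all add: w_def[of _ E2] w_def[of _ E3] We2 We3 act_bas_nil p_def q_def)
  have swap: "w j i = - w i j" if "L2 (bas i) (bas j) + L2 (bas j) (bas i) = 0" for i j
    using sym[of x "bas i" "bas j"] x linear_W(1)[of x]
    by (simp add: that w_def Vector_Spaces.linear_iff eq_neg_iff_add_eq_0 add.commute
        vector_space_pair.linear_0[OF _ linear_W(1)] vector_space_pair.intro
        vector_space_vec vector_space_over_itself.vector_space_axioms)
  have swaps: "w E2 E1 = - w E1 E2" "w E3 E1 = - w E1 E3" "w X1 E1 = - w E1 X1" "w X2 E1 = - w E1 X2"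
    "w E2 X1 = - w X1 E2" "w E3 X2 = - w X2 E3" "w X2 X1 = - w X1 X2"
    "w X1 X1 = - w X1 X1" "w X2 X2 = - w X2 X2"
    by (rule swap; simp add: vec5_eq_iff L2_nth axis_def)+
  have 32: "w E3 X1 = (2 - p) * w E1 E1"
  proof -
    have "L2 (bas E3) (bas X1) + L2 (bas X1) (bas E3) = 2 *s bas E3"
      by (simp add: vec5_eq_iff L2_nth axis_def)
    then have "2 * (rho x * w E1 E1) = rho x * (w E3 X1 + w X1 E3)"
      using sym[of x "bas E3" "bas X1"] linear_W(1)[of x]
      by (simp add: Vector_Spaces.linear_iff w_def We3)
    with x have "2 * w E1 E1 = w E3 X1 + w X1 E3"
      by (metis mult.left_commute mult_left_cancel)
    then show ?thesis
      by (simp add: zero algebra_simps)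
  qed
  have 22: "w E2 X2 = (1 - q) * f2"
    using zero(8) by (simp add: f2_def algebra_simps)
  have "(p - 1) * w E1 X2 = q * w E1 X1"
    using coc[of "bas E1" "bas X1" "bas X2"] by (simp add: basis_simps algebra_simps)
  then obtain f1 where f1: "\<not> (p = 1 \<and> q = 0) \<Longrightarrow> w E1 X1 = (p - 1) * f1 \<and> w E1 X2 = q * f1"
    using ratio_exists by (metis eq_iff_diff_eq_0)
  \<comment> \<open>A coboundary has the entry p f(x2) - q f(x1) at (x1, x2), which takes every
    value because p and q are not both zero.\<close>
  obtain g1 g2 where g: "w X1 X2 = p * g2 - q * g1"
  proof (cases "p = 0")
    case True
    then show thesis
      using pq_nonzero that[of 0 "- w X1 X2 / q"] by simp
  next
    case False
    then show thesis
      using that[of "w X1 X2 / p" 0] by simp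
  qed
  define f where "f = (\<lambda>i. case i of E1 \<Rightarrow> if p = 1 \<and> q = 0 then 0 else - f1 | E2 \<Rightarrow> f2
    | E3 \<Rightarrow> w E1 E1 | X1 \<Rightarrow> g1 | X2 \<Rightarrow> g2)"
  have diag: "w X1 X1 = 0" "w X2 X2 = 0"
    using swaps(8,9) by simp_all
  note table = zero swaps(1-7) 32 22 g diag
  show thesis
  proof (rule that)
    show "W u v = lin5 f (L2 u v) - lam u * lin5 f v - rho v * lin5 f u
      + (if p = 1 \<and> q = 0 then w E1 X1 * (u $ E1 * v $ X1 - u $ X1 * v $ E1)
          + w E1 X2 * (u $ E1 * v $ X2 - u $ X2 * v $ E1) else 0)" for u v
    proof (cases "p = 1 \<and> q = 0")
      case True
      then show ?thesis
        by (simp add: W_expand lin5_def L2_nth rho_eq assms f_def table algebra_simps)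
    next
      case False
      then show ?thesis
        by (simp add: W_expand lin5_def L2_nth rho_eq assms f_def table f1[OF False] algebra_simps)
    qed
  qed
qed

section \<open>Identification with the listed algebras\<close>

lemma isomorphic_rescaleI:
  assumes "d \<noteq> 0"
    and "\<And>u v. W u v = lin5 f (L2 u v) - lam u * lin5 f v - rho v * lin5 f u + d * B u v"
    and "\<And>u v s t. hatL2 k (emb6 u s) (emb6 v t) $ E4' = B u v + lam u * t + rho v * s"
  shows "isomorphic (ext_scale (*s) sh) (ext_br L2 \<omega> l r) (*s) (hatL2 k)"
proof (rule isomorphicI)
  show "1 / d \<noteq> 0"
    using assms(1) by simp
  \<comment> \<open>Dividing by \<open>d\<close> normalizes the class to \<open>B\<close>, and the
    section is changed by - f / d to absorb the coboundary.\<close>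
  show "hatL2 k (emb6 u s) (emb6 v t) $ E4' = 1 / d * W u v + lin5 (\<lambda>i. - f i / d) (L2 u v)
      + lam u * (t - lin5 (\<lambda>i. - f i / d) v) + rho v * (s - lin5 (\<lambda>i. - f i / d) u)" for u v s t
  proof -
    have "lin5 (\<lambda>i. - f i / d) u = - lin5 f u / d" for u
      using assms(1) by (simp add: lin5_def field_simps)
    then show ?thesis
      unfolding assms(2,3) using assms(1) by (simp only:) (simp add: field_simps)
  qed
qed

lemma isomorphic_hatL2: "\<exists>k. isomorphic (ext_scale (*s) sh) (ext_br L2 \<omega> l r) (*s) (hatL2 k)"
  using lam_cases
proof
  assume lam: "\<forall>u. lam u = 0"
  obtain f where
    W: "\<And>u v. W u v = lin5 f (L2 u v) - rho v * lin5 f u + w E2 E1 * u $ E2 * v $ E1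
      + w E3 E1 * u $ E3 * v $ E1 + w X2 E1 * u $ X2 * v $ E1
      + (if p = 0 \<and> q = 1 then w E2 X1 * u $ E2 * v $ X1 + w E2 X2 * u $ E2 * v $ X2 else 0)"
    and 21: "w E2 E1 \<noteq> 0 \<Longrightarrow> p = 1 \<and> q = 1" and 31: "w E3 E1 \<noteq> 0 \<Longrightarrow> p = 3 \<and> q = 0"
    and x21: "w X2 E1 \<noteq> 0 \<Longrightarrow> p = 1 \<and> q = 0"
    using lam by (rule right_extension_cocycle) blast
  \<comment> \<open>The weight conditions make the surviving entries mutually exclusive, apart from
    the pair at weight (0,1); if all vanish, \<open>W\<close> is a coboundary.\<close>
  consider (1) "w X2 E1 \<noteq> 0" | (2) "w E3 E1 \<noteq> 0" | (5) "w E2 E1 \<noteq> 0"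
    | (3) "w X2 E1 = 0" "w E3 E1 = 0" "w E2 E1 = 0" "p = 0" "q = 1" "w E2 X2 = 0" "w E2 X1 \<noteq> 0"
    | (4) "w X2 E1 = 0" "w E3 E1 = 0" "w E2 E1 = 0" "p = 0" "q = 1" "w E2 X2 \<noteq> 0"
  proof -
    have False if "w X2 E1 = 0" "w E3 E1 = 0" "w E2 E1 = 0" "p = 0 \<and> q = 1 \<Longrightarrow> w E2 X2 = 0 \<and> w E2 X1 = 0"
      using W_not_coboundary[of f] that by (auto simp: W lam split: if_splits)
    then show thesis
      using 1 2 3 4 5 by blast
  qed
  then show ?thesis
  proof cases
    case 1
    have vals: "p = 1" "q = 0" "w E2 E1 = 0" "w E3 E1 = 0"
      using 1 21 31 x21 by fastforce+
    have "isomorphic (ext_scale (*s) sh) (ext_br L2 \<omega> l r) (*s) (hatL2 Ext1)"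
      by (rule isomorphic_rescaleI[where f = f and B = "\<lambda>u v. u $ X2 * v $ E1", OF 1])
        (simp_all add: vals W lam rho_eq hatL2_nths)
    then show ?thesis ..
  next
    case 2
    have vals: "p = 3" "q = 0" "w E2 E1 = 0" "w X2 E1 = 0"
      using 2 21 31 x21 by fastforce+
    have "isomorphic (ext_scale (*s) sh) (ext_br L2 \<omega> l r) (*s) (hatL2 Ext2)"
      by (rule isomorphic_rescaleI[where f = f and B = "\<lambda>u v. u $ E3 * v $ E1", OF 2])
        (simp_all add: vals W lam rho_eq hatL2_nths)
    then show ?thesis ..
  next
    case 3
    have "isomorphic (ext_scale (*s) sh) (ext_br L2 \<omega> l r) (*s) (hatL2 Ext3)"
      by (rule isomorphic_rescaleI[where f = f and B = "\<lambda>u v. u $ E2 * v $ X1", OF 3(7)])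
        (use 3 in \<open>auto simp: W lam rho_eq hatL2_nths\<close>)
    then show ?thesis ..
  next
    case 4
    \<comment> \<open>Rescaling makes the entry at (e2, x2) equal to 1 and leaves the ratio of the
      two entries as the parameter.\<close>
    have "isomorphic (ext_scale (*s) sh) (ext_br L2 \<omega> l r) (*s) (hatL2 (Ext4 (w E2 X1 / w E2 X2)))"
      by (rule isomorphic_rescaleI[where f = f
            and B = "\<lambda>u v. u $ E2 * v $ X2 + w E2 X1 / w E2 X2 * u $ E2 * v $ X1", OF 4(6)])
        (use 4 in \<open>auto simp: W lam rho_eq hatL2_nths field_simps\<close>)
    then show ?thesis ..
  next
    case 5
    have vals: "p = 1" "q = 1" "w E3 E1 = 0" "w X2 E1 = 0"
      using 5 21 31 x21 by fastforce+
    have "isomorphic (ext_scale (*s) sh) (ext_br L2 \<omega> l r) (*s) (hatL2 Ext5)"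
      by (rule isomorphic_rescaleI[where f = f and B = "\<lambda>u v. u $ E2 * v $ E1", OF 5])
        (simp_all add: vals W lam rho_eq hatL2_nths algebra_simps)
    then show ?thesis ..
  qed
next
  assume lam: "\<forall>u. lam u = - rho u"
  obtain f where
    W: "\<And>u v. W u v = lin5 f (L2 u v) - lam u * lin5 f v - rho v * lin5 f u
      + (if p = 1 \<and> q = 0 then w E1 X1 * (u $ E1 * v $ X1 - u $ X1 * v $ E1)
          + w E1 X2 * (u $ E1 * v $ X2 - u $ X2 * v $ E1) else 0)"
    using lam by (rule symmetric_extension_cocycle) blast
  have pq: "p = 1" "q = 0" and nz: "w E1 X1 \<noteq> 0 \<or> w E1 X2 \<noteq> 0"
    using W_not_coboundary[of f] by (auto simp: W split: if_splits)
  show ?thesis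
  proof (cases "w E1 X2 = 0")
    case True
    with nz have "w E1 X1 \<noteq> 0"
      by simp
    then have "isomorphic (ext_scale (*s) sh) (ext_br L2 \<omega> l r) (*s) (hatL2 Ext6)"
      by (rule isomorphic_rescaleI[where f = f and B = "\<lambda>u v. u $ E1 * v $ X1 - u $ X1 * v $ E1"])
        (use True pq in \<open>auto simp: W lam rho_eq hatL2_nths\<close>)
    then show ?thesis ..
  next
    case False
    then have "isomorphic (ext_scale (*s) sh) (ext_br L2 \<omega> l r) (*s) (hatL2 (Ext7 (w E1 X1 / w E1 X2)))"
      by (rule isomorphic_rescaleI[where f = f
            and B = "\<lambda>u v. w E1 X1 / w E1 X2 * (u $ E1 * v $ X1 - u $ X1 * v $ E1)
              + (u $ E1 * v $ X2 - u $ X2 * v $ E1)"])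
        (use False pq in \<open>auto simp: W lam rho_eq hatL2_nths algebra_simps\<close>)
    then show ?thesis ..
  qed
qed

end

section \<open>The listed algebras are pairwise non-isomorphic\<close>

lemma bas_nth: "bas i $ j = (if j = i then 1 else 0)"
  by (simp add: axis_def)

lemma isomorphic_sym:
  assumes "isomorphic sa bra sb brb"
  shows "isomorphic sb brb sa bra"
proof -
  obtain \<phi> where \<phi>: "Vector_Spaces.linear sa sb \<phi>" "bij \<phi>" "\<And>x y. \<phi> (bra x y) = brb (\<phi> x) (\<phi> y)"
    using assms unfolding isomorphic_def by blast
  have inv: "inv \<phi> (\<phi> x) = x" "\<phi> (inv \<phi> y) = y" for x y
    using \<phi>(2) by (simp_all add: bij_is_inj bij_is_surj surj_f_inv_f)
  have "Vector_Spaces.linear sb sa (inv \<phi>)"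
    using \<phi>(1) unfolding Vector_Spaces.linear_iff by (metis inv)
  moreover have "inv \<phi> (brb x y) = bra (inv \<phi> x) (inv \<phi> y)" for x y
    by (metis inv \<phi>(3))
  moreover have "bij (inv \<phi>)"
    using \<phi>(2) by (rule bij_imp_bij_inv)
  ultimately show ?thesis
    unfolding isomorphic_def by blast
qed

text \<open>For a bilinear bracket this is symmetry on the derived algebra, which is spanned by
  products. Stated on products alone, it passes directly through isomorphisms.\<close>

definition nil_commutes :: "('a \<Rightarrow> 'a \<Rightarrow> 'a) \<Rightarrow> bool" where
  "nil_commutes br \<longleftrightarrow> (\<forall>a b c d. br (br a b) (br c d) = br (br c d) (br a b))"

definition nil_class_two :: "('a::zero \<Rightarrow> 'a \<Rightarrow> 'a) \<Rightarrow> bool" where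
  "nil_class_two br \<longleftrightarrow> (\<forall>a b c d e f. br (br (br a b) (br c d)) (br e f) = 0)"

lemma isomorphic_nil_commutes:
  assumes "isomorphic sa bra sb brb" "nil_commutes brb"
  shows "nil_commutes bra"
proof -
  obtain \<phi> where \<phi>: "bij \<phi>" "\<And>x y. \<phi> (bra x y) = brb (\<phi> x) (\<phi> y)"
    using assms unfolding isomorphic_def by blast
  have "\<phi> (bra (bra a b) (bra c d)) = \<phi> (bra (bra c d) (bra a b))" for a b c d
    using assms(2) unfolding nil_commutes_def \<phi>(2) by blast
  then show ?thesis
    unfolding nil_commutes_def using \<phi>(1) by (blast dest: bij_is_inj injD)
qed

lemma isomorphic_nil_class_two:
  assumes "isomorphic sa bra sb brb" "nil_class_two brb"
  shows "nil_class_two bra"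
proof -
  obtain \<phi> where \<phi>: "Vector_Spaces.linear sa sb \<phi>" "bij \<phi>" "\<And>x y. \<phi> (bra x y) = brb (\<phi> x) (\<phi> y)"
    using assms unfolding isomorphic_def by blast
  have "\<phi> 0 = 0"
    using \<phi>(1) unfolding Vector_Spaces.linear_iff by (metis add_cancel_right_right)
  then have "\<phi> x = 0 \<longleftrightarrow> x = 0" for x
    using \<phi>(2) by (metis bij_is_inj injD)
  moreover have "\<phi> (bra (bra (bra a b) (bra c d)) (bra e f)) = 0" for a b c d e f
    using assms(2) unfolding nil_class_two_def \<phi>(3) by blast
  ultimately show ?thesis
    unfolding nil_class_two_def by blast
qed

text \<open>Both e1 and e3 are products, and [e3, e1] = e4 while [e1, e3] = 0.\<close>

lemma not_nil_commutes_Ext2: "\<not> nil_commutes (hatL2 Ext2)"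
proof
  have eqs: "hatL2 Ext2 (bas E1') (bas X1') = bas E1'" "hatL2 Ext2 (bas E1') (bas E1') = bas E3'"
    by (simp_all add: vec6_eq_iff hatL2_nths bas_nth)
  assume "nil_commutes (hatL2 Ext2)"
  from this[unfolded nil_commutes_def, rule_format, of "bas E1'" "bas E1'" "bas E1'" "bas X1'"]
  show False
    by (simp add: eqs) (simp add: vec6_eq_iff hatL2_nths bas_nth)
qed

lemma not_nil_commutes_Ext5: "\<not> nil_commutes (hatL2 Ext5)"
proof
  have eqs: "hatL2 Ext5 (bas E1') (bas X1') = bas E1'" "hatL2 Ext5 (bas E2') (bas X2') = bas E2'"
    by (simp_all add: vec6_eq_iff hatL2_nths bas_nth)
  assume "nil_commutes (hatL2 Ext5)"
  from this[unfolded nil_commutes_def, rule_format, of "bas E2'" "bas X2'" "bas E1'" "bas X1'"]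
  show False
    by (simp add: eqs) (simp add: vec6_eq_iff hatL2_nths bas_nth)
qed

lemma nil_commutes_hatL2: "nil_commutes (hatL2 k) \<longleftrightarrow> k \<noteq> Ext2 \<and> k \<noteq> Ext5"
proof
  show "k \<noteq> Ext2 \<and> k \<noteq> Ext5" if "nil_commutes (hatL2 k)"
    using that not_nil_commutes_Ext2 not_nil_commutes_Ext5 by auto
  show "nil_commutes (hatL2 k)" if "k \<noteq> Ext2 \<and> k \<noteq> Ext5"
    using that by (cases k) (simp_all add: nil_commutes_def vec6_eq_iff hatL2_nths)
qed

lemma nil_class_two_Ext5: "nil_class_two (hatL2 Ext5)"
  by (simp add: nil_class_two_def vec6_eq_iff hatL2_nths)

text \<open>The triple product [[e1, e1], e1] = e4 of the element e1 = [e1, x1] survives.\<close>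

lemma not_nil_class_two_Ext2: "\<not> nil_class_two (hatL2 Ext2)"
proof
  have eqs: "hatL2 Ext2 (bas E1') (bas X1') = bas E1'" "hatL2 Ext2 (bas E1') (bas E1') = bas E3'"
    by (simp_all add: vec6_eq_iff hatL2_nths bas_nth)
  assume "nil_class_two (hatL2 Ext2)"
  from this[unfolded nil_class_two_def, rule_format,
      of "bas E1'" "bas X1'" "bas E1'" "bas X1'" "bas E1'" "bas X1'"]
  show False
    by (simp add: eqs) (simp add: vec6_eq_iff hatL2_nths bas_nth)
qed

lemma not_isomorphic_Ext2_Ext5: "\<not> isomorphic sa (hatL2 Ext2) sb (hatL2 Ext5)"
  using isomorphic_nil_class_two nil_class_two_Ext5 not_nil_class_two_Ext2 by blast

section \<open>Images of the basis under an isomorphism\<close>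

locale hatL2_embedding =
  fixes k k' :: label and \<phi> :: "complex^idx6 \<Rightarrow> complex^idx6"
  assumes linear_\<phi>: "Vector_Spaces.linear (*s) (*s) \<phi>"
    and inj_\<phi>: "inj \<phi>"
    and hom_\<phi>: "\<phi> (hatL2 k u v) = hatL2 k' (\<phi> u) (\<phi> v)"
    and k: "k \<noteq> Ext2" "k \<noteq> Ext5"
    and k': "k' \<noteq> Ext2" "k' \<noteq> Ext5"
begin

abbreviation "a \<equiv> \<phi> (bas E1')"
abbreviation "b \<equiv> \<phi> (bas E2')"
abbreviation "c \<equiv> \<phi> (bas E3')"
abbreviation "d \<equiv> \<phi> (bas E4')"
abbreviation "x \<equiv> \<phi> (bas X1')"
abbreviation "y \<equiv> \<phi> (bas X2')"

lemma \<phi>_linear: "\<phi> (u + v) = \<phi> u + \<phi> v" "\<phi> (t *s u) = t *s \<phi> u"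
  using linear_\<phi> by (simp_all add: Vector_Spaces.linear_iff)

lemma \<phi>_eq_0: "\<phi> u = 0 \<Longrightarrow> u = 0"
  using \<phi>_linear(2)[of 0 0] injD[OF inj_\<phi>, of u 0] by simp

lemma hom_eq: "hatL2 k u v = w \<Longrightarrow> hatL2 k' (\<phi> u) (\<phi> v) = \<phi> w"
  using hom_\<phi> by metis

lemma nil_d: "d $ X1' = 0" "d $ X2' = 0"
proof -
  \<comment> \<open>In the remaining tables \<open>e4\<close> has weight (1,0) or (0,1), so x1 + x2
    fixes it in every case. Its image is thus a product, without components at x1 and x2.\<close>
  have "hatL2 k (bas E4') (bas X1' + bas X2') = bas E4'"
    using k by (cases k) (simp_all add: vec6_eq_iff hatL2_nths bas_nth)
  from hom_eq[OF this] show "d $ X1' = 0" "d $ X2' = 0"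
    by (metis hatL2_nths(4), metis hatL2_nths(5))
qed

lemma br_aa: "hatL2 k' a a = c"
  by (rule hom_eq) (use k in \<open>cases k; simp add: vec6_eq_iff hatL2_nths bas_nth\<close>)

lemma br_bb: "hatL2 k' b b = 0"
  using hom_eq[of "bas E2'" "bas E2'" "0 *s 0"] k \<phi>_linear(2)[of 0 0]
  by (cases k; simp add: vec6_eq_iff hatL2_nths bas_nth)

lemma br_dd: "hatL2 k' d d = 0"
  using hom_eq[of "bas E4'" "bas E4'" "0 *s 0"] k \<phi>_linear(2)[of 0 0]
  by (cases k; simp add: vec6_eq_iff hatL2_nths bas_nth)

text \<open>Leaving the coefficient of \<open>d\<close> open treats all remaining tables at once;
  \<open>d\<close> has no component at x1, x2 or e1, so \<open>t\<close> drops out of the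
  comparisons there.\<close>

lemma br_ax: obtains t where "hatL2 k' a x = a + t *s d"
proof -
  have "\<exists>t. hatL2 k (bas E1') (bas X1') = bas E1' + t *s bas E4'"
    using k by (intro exI[of _ "hatL2 k (bas E1') (bas X1') $ E4'"])
      (cases k; simp add: vec6_eq_iff hatL2_nths bas_nth)
  then show thesis
    using that hom_eq by (metis \<phi>_linear)
qed

lemma br_ay: obtains t where "hatL2 k' a y = t *s d"
proof -
  have "\<exists>t. hatL2 k (bas E1') (bas X2') = t *s bas E4'"
    using k by (intro exI[of _ "hatL2 k (bas E1') (bas X2') $ E4'"])
      (cases k; simp add: vec6_eq_iff hatL2_nths bas_nth)
  then show thesis
    using that hom_eq by (metis \<phi>_linear)
qed

lemma br_by: obtains t where "hatL2 k' b y = b + t *s d"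
proof -
  have "\<exists>t. hatL2 k (bas E2') (bas X2') = bas E2' + t *s bas E4'"
    using k by (intro exI[of _ "hatL2 k (bas E2') (bas X2') $ E4'"])
      (cases k; simp add: vec6_eq_iff hatL2_nths bas_nth)
  then show thesis
    using that hom_eq by (metis \<phi>_linear)
qed

lemma nil_a: "a $ X1' = 0" "a $ X2' = 0"
proof -
  obtain t where "hatL2 k' a x = a + t *s d"
    by (rule br_ax)
  then have "a $ X1' = hatL2 k' a x $ X1'" "a $ X2' = hatL2 k' a x $ X2'"
    by (simp_all add: nil_d)
  then show "a $ X1' = 0" "a $ X2' = 0"
    by (simp_all add: hatL2_nths)
qed

lemma nil_b: "b $ X1' = 0" "b $ X2' = 0"
proof -
  obtain t where "hatL2 k' b y = b + t *s d"
    by (rule br_by)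
  then have "b $ X1' = hatL2 k' b y $ X1'" "b $ X2' = hatL2 k' b y $ X2'"
    by (simp_all add: nil_d)
  then show "b $ X1' = 0" "b $ X2' = 0"
    by (simp_all add: hatL2_nths)
qed

lemma c_eq: "c = (a $ E1')^2 *s bas E3'"
  unfolding br_aa[symmetric] using k' nil_a
  by (cases k'; simp add: vec6_eq_iff hatL2_nths bas_nth power2_eq_square)

lemma a1_nonzero: "a $ E1' \<noteq> 0"
  using c_eq \<phi>_eq_0[of "bas E3'"] by (auto simp: vec6_eq_iff bas_nth)

lemma b1_zero: "b $ E1' = 0" and d1_zero: "d $ E1' = 0"
  using arg_cong[OF br_bb, of "\<lambda>u. u $ E3'"] arg_cong[OF br_dd, of "\<lambda>u. u $ E3'"]
  by (simp_all add: hatL2_nths nil_b nil_d)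

lemma x_X1: "x $ X1' = 1"
proof -
  obtain t where "hatL2 k' a x = a + t *s d"
    by (rule br_ax)
  then have "hatL2 k' a x $ E1' = a $ E1'"
    by (simp add: d1_zero)
  then show ?thesis
    using a1_nonzero by (simp add: hatL2_nths nil_a)
qed

lemma y_X1: "y $ X1' = 0"
proof -
  obtain t where "hatL2 k' a y = t *s d"
    by (rule br_ay)
  then have "hatL2 k' a y $ E1' = 0"
    by (simp add: d1_zero)
  then show ?thesis
    using a1_nonzero by (simp add: hatL2_nths nil_a)
qed

text \<open>By \<open>c_eq\<close> the line of e3 is the image of the line of e3, so injectivity
  keeps the images of the other combinations off it.\<close>

lemma multiple_of_bas3:
  assumes "\<phi> (s *s bas E2' + t *s bas E4') = r *s bas E3'"
  shows "s = 0" "t = 0"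
proof -
  have "\<phi> (s *s bas E2' + t *s bas E4' + (- r / (a $ E1')^2) *s bas E3') = 0"
    using assms a1_nonzero
    by (simp only: \<phi>_linear c_eq) (simp add: vec6_eq_iff bas_nth)
  from \<phi>_eq_0[OF this] show "s = 0" "t = 0"
    by (simp_all add: vec6_eq_iff bas_nth)
qed

lemma d4_nonzero:
  assumes "d $ E2' = 0"
  shows "d $ E4' \<noteq> 0"
proof
  assume "d $ E4' = 0"
  with assms have "d = d $ E3' *s bas E3'"
    by (simp add: vec6_eq_iff bas_nth nil_d d1_zero)
  then have "\<phi> (0 *s bas E2' + 1 *s bas E4') = d $ E3' *s bas E3'"
    by simp
  then show False
    using multiple_of_bas3(2) by fastforce
qed

lemma b2_nonzero:
  assumes "d $ E2' = 0"
  shows "b $ E2' \<noteq> 0"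
proof
  assume "b $ E2' = 0"
  \<comment> \<open>This combination of \<open>b\<close> and \<open>d\<close> is chosen to cancel
    the \<open>E4'\<close> coordinate, leaving only a multiple of e3.\<close>
  with assms have "\<phi> (d $ E4' *s bas E2' + (- b $ E4') *s bas E4')
      = (d $ E4' * b $ E3' - b $ E4' * d $ E3') *s bas E3'"
    by (simp only: \<phi>_linear) (simp add: vec6_eq_iff bas_nth nil_d d1_zero nil_b b1_zero)
  then show False
    using multiple_of_bas3(1) d4_nonzero[OF assms] by blast
qed

section \<open>Comparison of weights and parameters\<close>

lemmas \<phi>_nths = nil_a nil_b nil_d b1_zero d1_zero x_X1 y_X1

lemma hom_nth:
  assumes "hatL2 k u v = w"
  shows "hatL2 k' (\<phi> u) (\<phi> v) $ i = \<phi> w $ i"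
  using hom_eq[OF assms] by simp

lemmas table_simps = vec6_eq_iff hatL2_nths bas_nth

lemma hom_nth_0: "hatL2 k u v = 0 \<Longrightarrow> hatL2 k' (\<phi> u) (\<phi> v) $ i = 0"
  using hom_nth[of u v "0 *s 0"] \<phi>_linear(2)[of 0 0] by simp

text \<open>Right multiplication by \<open>y\<close> fixes \<open>b\<close>, which forces y to have
  a component at x2. As it kills \<open>d\<close>, the e2 coordinate of \<open>d\<close> vanishes,
  and the e2 coordinates of [b, y] = b and [b, x] = 0 give the rest.\<close>

lemma Ext1_Ext6_Ext7_weights:
  assumes k: "k \<in> {Ext1, Ext6} \<union> range Ext7" and k': "k' \<in> {Ext1, Ext6} \<union> range Ext7"
  shows "d $ E2' = 0" "y $ X2' = 1" "x $ X2' = 0"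
proof -
  have by_eq: "hatL2 k (bas E2') (bas X2') = bas E2'"
    and bx_eq: "hatL2 k (bas E2') (bas X1') = 0"
    and dy_eq: "hatL2 k (bas E4') (bas X2') = 0"
    using k by (auto simp: table_simps)
  have b_y: "hatL2 k' b y $ i = b $ i" for i
    using hom_nth[OF by_eq] by simp
  have "y $ X2' \<noteq> 0"
  proof
    assume "y $ X2' = 0"
    then have "hatL2 k' b y $ i = 0" for i
      using k' by (cases i) (auto simp: hatL2_nths \<phi>_nths)
    then have "b = 0"
      using b_y by (simp add: vec_eq_iff)
    then show False
      using \<phi>_eq_0[of "bas E2'"] by (simp add: vec6_eq_iff bas_nth)
  qed
  then show d2: "d $ E2' = 0"
    using hom_nth_0[OF dy_eq, of "E2'"] by (simp add: hatL2_nths)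
  show "y $ X2' = 1"
    using b_y[of "E2'"] b2_nonzero[OF d2] by (simp add: hatL2_nths)
  show "x $ X2' = 0"
    using hom_nth_0[OF bx_eq, of "E2'"] b2_nonzero[OF d2] by (simp add: hatL2_nths)
qed

text \<open>The left action separates them: [x1, e4] is 0 in \<open>Ext1\<close> and - e4 in the
  targets.\<close>

lemma not_Ext1_to_Ext6_Ext7:
  assumes "k = Ext1" "k' \<in> {Ext6} \<union> range Ext7"
  shows False
proof -
  have "hatL2 k (bas X1') (bas E4') = 0"
    using assms(1) by (simp add: table_simps)
  from hom_nth_0[OF this, of "E4'"] have "d $ E4' = 0"
    using assms(2) by (auto simp: hatL2_nths \<phi>_nths)
  then show False
    using d4_nonzero Ext1_Ext6_Ext7_weights(1) assms by auto
qed

lemma not_Ext6_to_Ext7: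
  assumes "k = Ext6" "k' = Ext7 \<delta>"
  shows False
proof -
  have "hatL2 k (bas E1') (bas X2') = 0"
    using assms(1) by (simp add: table_simps)
  from hom_nth_0[OF this, of "E4'"] show False
    using Ext1_Ext6_Ext7_weights assms a1_nonzero by (simp add: hatL2_nths \<phi>_nths)
qed

lemma Ext7_parameter:
  assumes "k = Ext7 \<delta>" "k' = Ext7 \<delta>'"
  shows "\<delta> = \<delta>'"
proof -
  have facts: "y $ X2' = 1" "x $ X2' = 0"
    using Ext1_Ext6_Ext7_weights assms by simp_all
  have "hatL2 k (bas E1') (bas X2') = bas E4'"
    using assms(1) by (simp add: table_simps)
  from hom_nth[OF this, of "E4'"] have "d $ E4' = a $ E1'"
    using assms(2) by (simp add: hatL2_nths \<phi>_nths facts)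
  moreover have "hatL2 k (bas E1') (bas X1') = bas E1' + \<delta> *s bas E4'"
    using assms(1) by (simp add: table_simps)
  from hom_nth[OF this, of "E4'"] have "\<delta>' * a $ E1' = \<delta> * d $ E4'"
    using assms(2) by (simp add: hatL2_nths \<phi>_nths \<phi>_linear facts)
  ultimately show ?thesis
    using a1_nonzero by simp
qed

text \<open>In the source x1 kills \<open>e4\<close>, in the targets it does not, so
  \<open>d\<close> must have an e2 component. That forces \<open>x\<close> and \<open>y\<close> to
  act on the e2 coordinate by 0 and 1, which contradicts the \<open>e4\<close> term in [e2, x1] or
  [e2, x2].\<close>

lemma not_Ext3_Ext4_to_Ext1_Ext6_Ext7:
  assumes k: "k \<in> {Ext3} \<union> range Ext4" and k': "k' \<in> {Ext1, Ext6} \<union> range Ext7"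
  shows False
proof -
  have dx_eq: "hatL2 k (bas E4') (bas X1') = 0" and dy_eq: "hatL2 k (bas E4') (bas X2') = bas E4'"
    using k by (auto simp: table_simps)
  have d4: "d $ E4' = 0"
    using hom_nth_0[OF dx_eq, of "E4'"] k' by (auto simp: hatL2_nths \<phi>_nths)
  then have d2: "d $ E2' \<noteq> 0"
    using d4_nonzero by blast
  then have x2: "x $ X2' = 0" and y2: "y $ X2' = 1"
    using hom_nth_0[OF dx_eq, of "E2'"] hom_nth[OF dy_eq, of "E2'"] by (simp_all add: hatL2_nths)
  from k show False
  proof
    assume "k \<in> {Ext3}"
    then have "hatL2 k (bas E2') (bas X1') = bas E4'"
      by (simp add: table_simps)
    from hom_nth[OF this, of "E2'"] d2 show False
      by (simp add: hatL2_nths x2)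
  next
    assume "k \<in> range Ext4"
    then have "hatL2 k (bas E2') (bas X2') = bas E2' + bas E4'"
      by (auto simp: table_simps)
    from hom_nth[OF this, of "E2'"] d2 show False
      by (simp add: hatL2_nths y2 \<phi>_linear)
  qed
qed

text \<open>In \<open>Ext4\<close> right multiplication by x2 is a Jordan block on the span of e2
  and e4, so its eigenvector \<open>d\<close> has no e2 component.\<close>

lemma Ext3_Ext4_to_Ext4_weights:
  assumes k: "k \<in> {Ext3} \<union> range Ext4" and k': "k' \<in> range Ext4"
  shows "d $ E2' = 0" "y $ X2' = 1" "x $ X2' = 0"
proof -
  have dx_eq: "hatL2 k (bas E4') (bas X1') = 0" and dy_eq: "hatL2 k (bas E4') (bas X2') = bas E4'"
    using k by (auto simp: table_simps)
  show d2: "d $ E2' = 0"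
  proof (rule ccontr)
    assume d2: "d $ E2' \<noteq> 0"
    then have "y $ X2' = 1"
      using hom_nth[OF dy_eq, of "E2'"] by (simp add: hatL2_nths)
    with d2 show False
      using hom_nth[OF dy_eq, of "E4'"] k' by (auto simp: hatL2_nths \<phi>_nths)
  qed
  show "y $ X2' = 1" "x $ X2' = 0"
    using hom_nth[OF dy_eq, of "E4'"] hom_nth_0[OF dx_eq, of "E4'"] k' d2 d4_nonzero
    by (auto simp: hatL2_nths \<phi>_nths)
qed

text \<open>On the span of e2 and e4, x2 acts as the identity in \<open>Ext3\<close> but as a Jordan
  block in \<open>Ext4\<close>.\<close>

lemma not_Ext3_to_Ext4:
  assumes "k = Ext3" "k' = Ext4 \<delta>"
  shows False
proof -
  have facts: "d $ E2' = 0" "y $ X2' = 1"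
    using Ext3_Ext4_to_Ext4_weights assms by simp_all
  have "hatL2 k (bas E2') (bas X2') = bas E2'"
    using assms(1) by (simp add: table_simps)
  from hom_nth[OF this, of "E4'"] show False
    using assms(2) b2_nonzero by (simp add: hatL2_nths \<phi>_nths facts)
qed

lemma Ext4_parameter:
  assumes "k = Ext4 \<delta>" "k' = Ext4 \<delta>'"
  shows "\<delta> = \<delta>'"
proof -
  have facts: "d $ E2' = 0" "y $ X2' = 1" "x $ X2' = 0"
    using Ext3_Ext4_to_Ext4_weights assms by simp_all
  have "hatL2 k (bas E2') (bas X2') = bas E2' + bas E4'"
    using assms(1) by (simp add: table_simps)
  from hom_nth[OF this, of "E4'"] have "d $ E4' = b $ E2'"
    using assms(2) by (simp add: hatL2_nths \<phi>_nths \<phi>_linear facts)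
  moreover have "hatL2 k (bas E2') (bas X1') = \<delta> *s bas E4'"
    using assms(1) by (simp add: table_simps)
  from hom_nth[OF this, of "E4'"] have "\<delta>' * b $ E2' = \<delta> * d $ E4'"
    using assms(2) by (simp add: hatL2_nths \<phi>_nths \<phi>_linear facts)
  ultimately show ?thesis
    using b2_nonzero facts(1) by simp
qed

end

text \<open>This enumeration makes it enough to exclude isomorphisms in one direction.\<close>

fun rank :: "label \<Rightarrow> nat" where
  "rank Ext3 = 0"
| "rank (Ext4 \<delta>) = 1"
| "rank Ext1 = 2"
| "rank Ext6 = 3"
| "rank (Ext7 \<delta>) = 4"
| "rank Ext2 = 5"
| "rank Ext5 = 6"

lemma isomorphic_hatL2_rank_le:
  assumes iso: "isomorphic (*s) (hatL2 k) (*s) (hatL2 k')" and "rank k \<le> rank k'"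
  shows "k = k'"
proof (cases "k \<in> {Ext2, Ext5} \<or> k' \<in> {Ext2, Ext5}")
  case True
  \<comment> \<open>As \<open>nil_commutes\<close> transfers both ways, one exceptional label forces
    the other to be exceptional.\<close>
  then have "k \<in> {Ext2, Ext5}" "k' \<in> {Ext2, Ext5}"
    using isomorphic_nil_commutes[OF iso] isomorphic_nil_commutes[OF isomorphic_sym[OF iso]]
    unfolding nil_commutes_hatL2 by blast+
  moreover have "\<not> (k = Ext5 \<and> k' = Ext2)"
    using assms(2) by auto
  moreover have "\<not> (k = Ext2 \<and> k' = Ext5)"
    using iso not_isomorphic_Ext2_Ext5 by blast
  ultimately show ?thesis
    by blast
next
  case False
  obtain \<phi> where \<phi>: "Vector_Spaces.linear (*s) (*s) \<phi>" "bij \<phi>"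
    "\<And>u v. \<phi> (hatL2 k u v) = hatL2 k' (\<phi> u) (\<phi> v)"
    using iso unfolding isomorphic_def by blast
  interpret hatL2_embedding k k' \<phi>
    by (rule hatL2_embedding.intro) (use \<phi> False in \<open>auto dest: bij_is_inj\<close>)
  have targets: "k' \<in> {Ext3} \<union> range Ext4 \<or> k' \<in> {Ext1, Ext6} \<union> range Ext7"
    using False by (cases k') auto
  show ?thesis
  proof (cases k)
    case Ext3
    with targets assms(2) not_Ext3_Ext4_to_Ext1_Ext6_Ext7 not_Ext3_to_Ext4 show ?thesis
      by auto
  next
    case (Ext4 \<delta>)
    with targets assms(2) not_Ext3_Ext4_to_Ext1_Ext6_Ext7 Ext4_parameter show ?thesis
      by auto
  next
    case Ext1
    with targets assms(2) not_Ext1_to_Ext6_Ext7 show ?thesis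
      by auto
  next
    case Ext6
    with targets assms(2) not_Ext6_to_Ext7 show ?thesis
      by auto
  next
    case (Ext7 \<delta>)
    with targets assms(2) Ext7_parameter show ?thesis
      by auto
  qed (use False in auto)
qed

lemma isomorphic_hatL2_imp_eq:
  assumes "isomorphic (*s) (hatL2 k) (*s) (hatL2 k')"
  shows "k = k'"
  using isomorphic_hatL2_rank_le[OF assms] isomorphic_hatL2_rank_le[OF isomorphic_sym[OF assms]]
  by (cases "rank k \<le> rank k'") auto

theorem theorem4p11:
  fixes sh :: "complex \<Rightarrow> 'h::ab_group_add \<Rightarrow> 'h" and e4 :: 'h
  assumes "vector_space sh" and "e4 \<noteq> 0" and "module.span sh {e4} = UNIV"
  shows "(\<forall>l r \<omega>. leibniz_cocycle (*s) L2 sh l r \<omega> \<longrightarrow>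
            L2_nil \<subseteq> act_ker l \<inter> act_ker r \<longrightarrow>
            \<not> trivial_rep l r \<longrightarrow> \<not> coboundary (*s) L2 sh l r \<omega> \<longrightarrow>
            (\<exists>k. isomorphic (ext_scale (*s) sh) (ext_br L2 \<omega> l r) (*s) (hatL2 k)))
       \<and> (\<forall>k k'. k \<noteq> k' \<longrightarrow> \<not> isomorphic (*s) (hatL2 k) (*s) (hatL2 k'))"
proof (intro conjI allI impI)
  fix l r \<omega>
  assume "leibniz_cocycle (*s) L2 sh l r \<omega>" "L2_nil \<subseteq> act_ker l \<inter> act_ker r"
    "\<not> trivial_rep l r" "\<not> coboundary (*s) L2 sh l r \<omega>"
  then interpret L2_line_extension sh l r \<omega> e4
    using assms(2,3) by (intro L2_line_extension.intro L2_line_extension_axioms.intro)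
  show "\<exists>k. isomorphic (ext_scale (*s) sh) (ext_br L2 \<omega> l r) (*s) (hatL2 k)"
    by (rule isomorphic_hatL2)
next
  fix k k' :: label
  assume "k \<noteq> k'"
  then show "\<not> isomorphic (*s) (hatL2 k) (*s) (hatL2 k')"
    using isomorphic_hatL2_imp_eq by blast
qed

end
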